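(* Let $n\ge1$ and let $\widehat\Phi_n$ be the undirected graph with vertex set $\{0,1\}^n$ in which distinct vertices $x,y$ are adjacent if and only if $y-x$ or $x-y$ is an alternating sequence. Let $\theta(a_1,\ldots,a_n)=(\overline{a_n},a_1,\ldots,a_{n-1})$, where $\overline{x}=1-x$, and $\tau(a_1,\ldots,a_n)=(a_n,\ldots,a_2,a_1)$. Then $\theta$ and $\tau$ induce an action of the dihedral group $D_{2n}$ on $\widehat\Phi_n$ as a group of automorphisms; that is, there is a group homomorphism from $D_{2n}=\langle r,s\mid r^{2n}=s^2=1,\ srs^{-1}=r^{-1}\rangle$ to the automorphism group of $\widehat\Phi_n$ sending $r\mapsto\theta$ and $s\mapsto\tau$.
   Context: A sequence $(\alpha_1,\ldots,\alpha_n)$ is alternating if each $\alpha_i\in\{1,0,-1\}$ and its nonzero entries, read left to right, form the pattern $1,-1,1,-1,\ldots,-1,1$. Here $D_{2n}$ denotes the dihedral group with rotation of order $2n$ (order $4n$). The graph $\widehat\Phi_n$ is the Hasse diagram of the poset on $\{0,1\}^n$ in which $y$ covers $x$ iff $y-x$ is alternating. *)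

theory Defs
  imports "HOL-Algebra.Group" "HOL-Algebra.Bij"
begin

section \<open>Groups given by generators and relations\<close>

text \<open>The letter \<open>(g, True)\<close> stands for the generator \<open>g\<close>, and \<open>(g, False)\<close> for its formal
  inverse. A relation \<open>u = v\<close> is the pair \<open>(u, v)\<close>.\<close>

type_synonym 'g word = "('g \<times> bool) list"

inductive pres_eq :: "('g word \<times> 'g word) set \<Rightarrow> 'g word \<Rightarrow> 'g word \<Rightarrow> bool"
  for R :: "('g word \<times> 'g word) set" where
  refl: "pres_eq R u u"
| sym: "pres_eq R u v \<Longrightarrow> pres_eq R v u"
| trans: "pres_eq R u v \<Longrightarrow> pres_eq R v w \<Longrightarrow> pres_eq R u w"
| append: "pres_eq R u u' \<Longrightarrow> pres_eq R v v' \<Longrightarrow> pres_eq R (u @ v) (u' @ v')"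
| cancel: "pres_eq R [(g, b), (g, \<not> b)] []"
| rel: "(u, v) \<in> R \<Longrightarrow> pres_eq R u v"

definition pres_class :: "('g word \<times> 'g word) set \<Rightarrow> 'g word \<Rightarrow> 'g word set" where
  "pres_class R u = {v. pres_eq R u v}"

definition presented_group :: "('g word \<times> 'g word) set \<Rightarrow> 'g word set monoid" where
  "presented_group R =
    \<lparr>carrier = range (pres_class R),
     mult = (\<lambda>A B. \<Union>u\<in>A. \<Union>v\<in>B. pres_class R (u @ v)),
     one = pres_class R []\<rparr>"

section \<open>Dihedral groups\<close>

datatype dih_gen = Rot | Refl

definition dihedral_rels :: "nat \<Rightarrow> (dih_gen word \<times> dih_gen word) set" where
  "dihedral_rels m =
    {(replicate m (Rot, True), []),
     ([(Refl, True), (Refl, True)], []),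
     ([(Refl, True), (Rot, True), (Refl, False)], [(Rot, False)])}"

text \<open>The index is the order of the rotation, so the group has order \<open>2 * m\<close> for \<open>m > 0\<close>.\<close>

definition dihedral_group :: "nat \<Rightarrow> dih_gen word set monoid" where
  "dihedral_group m = presented_group (dihedral_rels m)"

definition dih_r :: "nat \<Rightarrow> dih_gen word set" where
  "dih_r m = pres_class (dihedral_rels m) [(Rot, True)]"

definition dih_s :: "nat \<Rightarrow> dih_gen word set" where
  "dih_s m = pres_class (dihedral_rels m) [(Refl, True)]"

section \<open>Simple graphs and their automorphism groups\<close>

record 'v ugraph =
  uverts :: "'v set"
  uedges :: "'v set set"

text \<open>As in \<^const>\<open>BijGroup\<close>, bijections of the vertex set are represented by functions that
  are extensional on it.\<close>

definition graph_auts :: "'v ugraph \<Rightarrow> ('v \<Rightarrow> 'v) set" where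
  "graph_auts G =
    {f \<in> Bij (uverts G).
      \<forall>x\<in>uverts G. \<forall>y\<in>uverts G. {f x, f y} \<in> uedges G \<longleftrightarrow> {x, y} \<in> uedges G}"

definition graph_aut_group :: "'v ugraph \<Rightarrow> ('v \<Rightarrow> 'v) monoid" where
  "graph_aut_group G = (BijGroup (uverts G))\<lparr>carrier := graph_auts G\<rparr>"

section \<open>The graph of alternating differences\<close>

text \<open>The pattern \<open>1, -1, \<dots>, -1, 1\<close> begins and ends with \<open>1\<close>, so it has odd length; the
  one-term pattern \<open>1\<close> is included and the empty one is not.\<close>

definition alternating :: "int list \<Rightarrow> bool" where
  "alternating as \<longleftrightarrow> set as \<subseteq> {1, 0, -1} \<and>
    (\<exists>k. filter (\<lambda>a. a \<noteq> 0) as = map (\<lambda>i. (-1) ^ i) [0..<2 * k + 1])"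

definition seq_diff :: "int list \<Rightarrow> int list \<Rightarrow> int list" where
  "seq_diff y x = map2 (-) y x"

definition bin_seqs :: "nat \<Rightarrow> int list set" where
  "bin_seqs n = {x. length x = n \<and> set x \<subseteq> {0, 1}}"

definition Phi_hat :: "nat \<Rightarrow> int list ugraph" where
  "Phi_hat n =
    \<lparr>uverts = bin_seqs n,
     uedges = {{x, y} |x y. x \<in> bin_seqs n \<and> y \<in> bin_seqs n \<and> x \<noteq> y \<and>
       (alternating (seq_diff y x) \<or> alternating (seq_diff x y))}\<rparr>"

definition theta :: "int list \<Rightarrow> int list" where
  "theta a = (1 - last a) # butlast a"

definition tau :: "int list \<Rightarrow> int list" where
  "tau a = rev a"

end

theory Submission
  imports Defs
begin

text \<open>Adjacency of \<open>x\<close> and \<open>y\<close> says that, up to a global sign, the nonzero entries of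
  \<open>y - x\<close> alternate in sign and are odd in number. Applying \<open>\<theta>\<close> moves the last entry of the
  difference to the front with its sign changed; since the first and last nonzero entries agree,
  the result still alternates, possibly with the opposite global sign. Reversal keeps the pattern.
  Moreover \<open>\<theta>\<^sup>n\<close> is complementation, so \<open>\<theta>\<close> has order dividing \<open>2n\<close>, and
  \<open>\<tau>\<theta>\<tau>\<theta> = 1\<close>; the universal property of the presentation yields the homomorphism.\<close>

section \<open>The universal property of a presentation\<close>

lemma pres_class_eq_iff: "pres_class R u = pres_class R v \<longleftrightarrow> pres_eq R u v"
  unfolding pres_class_def
  by (auto intro: pres_eq.refl pres_eq.sym pres_eq.trans)

text \<open>The product is a union over all pairs of representatives. By
  \<open>pres_eq.append\<close> every member of that union is the same class, and the union
  collapses because classes are nonempty.\<close>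

lemma mult_pres_class:
  "pres_class R u \<otimes>\<^bsub>presented_group R\<^esub> pres_class R v = pres_class R (u @ v)"
proof -
  have *: "pres_class R (u' @ v') = pres_class R (u @ v)"
    if "u' \<in> pres_class R u" "v' \<in> pres_class R v" for u' v'
    unfolding pres_class_eq_iff using that
    by (intro pres_eq.sym[OF pres_eq.append]) (simp_all add: pres_class_def)
  have "u \<in> pres_class R u" "v \<in> pres_class R v"
    by (auto simp: pres_class_def intro: pres_eq.refl)
  then have ne: "pres_class R u \<noteq> {}" "pres_class R v \<noteq> {}"
    by blast+
  have "pres_class R u \<otimes>\<^bsub>presented_group R\<^esub> pres_class R v
      = (\<Union>u'\<in>pres_class R u. \<Union>v'\<in>pres_class R v. pres_class R (u' @ v'))"
    by (simp add: presented_group_def)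
  also have "\<dots> = (\<Union>u'\<in>pres_class R u. \<Union>v'\<in>pres_class R v. pres_class R (u @ v))"
    by (intro SUP_cong[OF HOL.refl] *)
  also have "\<dots> = pres_class R (u @ v)"
    using ne by simp
  finally show ?thesis .
qed

definition inv_word :: "'g word \<Rightarrow> 'g word" where
  "inv_word w = rev (map (\<lambda>(g, b). (g, \<not> b)) w)"

text \<open>Cancellation happens at the junction of the two words, from the inside outwards. Left
  inverses are all that \<open>groupI\<close> asks for.\<close>

lemma pres_eq_inv_word: "pres_eq R (inv_word w @ w) []"
proof (induction w)
  case Nil
  show ?case by (simp add: inv_word_def pres_eq.refl)
next
  case (Cons a w)
  obtain g b where a: "a = (g, b)" by fastforce
  have "pres_eq R [(g, \<not> b), (g, b)] []"
    using pres_eq.cancel[of R g "\<not> b"] by simp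
  then have "pres_eq R (inv_word w @ ([(g, \<not> b), (g, b)] @ w)) (inv_word w @ ([] @ w))"
    by (intro pres_eq.append pres_eq.refl)
  with Cons.IH show ?case
    by (auto simp: inv_word_def a intro: pres_eq.trans)
qed

lemma group_presented_group: "group (presented_group R)"
proof (rule groupI)
  show "\<one>\<^bsub>presented_group R\<^esub> \<in> carrier (presented_group R)"
    by (simp add: presented_group_def)
next
  fix A B C
  assume "A \<in> carrier (presented_group R)" "B \<in> carrier (presented_group R)"
  then obtain u v where AB: "A = pres_class R u" "B = pres_class R v"
    by (auto simp: presented_group_def)
  show "A \<otimes>\<^bsub>presented_group R\<^esub> B \<in> carrier (presented_group R)"
    unfolding AB mult_pres_class by (simp add: presented_group_def)
  assume "C \<in> carrier (presented_group R)"
  then obtain w where C: "C = pres_class R w"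
    by (auto simp: presented_group_def)
  show "A \<otimes>\<^bsub>presented_group R\<^esub> B \<otimes>\<^bsub>presented_group R\<^esub> C
      = A \<otimes>\<^bsub>presented_group R\<^esub> (B \<otimes>\<^bsub>presented_group R\<^esub> C)"
    unfolding AB C mult_pres_class by simp
next
  fix A
  assume "A \<in> carrier (presented_group R)"
  then obtain u where A: "A = pres_class R u"
    by (auto simp: presented_group_def)
  have one: "\<one>\<^bsub>presented_group R\<^esub> = pres_class R []"
    by (simp add: presented_group_def)
  show "\<one>\<^bsub>presented_group R\<^esub> \<otimes>\<^bsub>presented_group R\<^esub> A = A"
    unfolding A one mult_pres_class by simp
  have "pres_class R (inv_word u) \<otimes>\<^bsub>presented_group R\<^esub> A = \<one>\<^bsub>presented_group R\<^esub>"
    unfolding A one mult_pres_class pres_class_eq_iff by (rule pres_eq_inv_word)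
  then show "\<exists>B\<in>carrier (presented_group R).
      B \<otimes>\<^bsub>presented_group R\<^esub> A = \<one>\<^bsub>presented_group R\<^esub>"
    by (auto simp: presented_group_def)
qed

section \<open>Evaluation of words in a group and the induced homomorphisms\<close>

fun word_eval :: "('a, 'b) monoid_scheme \<Rightarrow> ('g \<Rightarrow> 'a) \<Rightarrow> 'g word \<Rightarrow> 'a" where
  "word_eval G f [] = \<one>\<^bsub>G\<^esub>"
| "word_eval G f ((g, b) # w) = (if b then f g else inv\<^bsub>G\<^esub> (f g)) \<otimes>\<^bsub>G\<^esub> word_eval G f w"

context group
begin

lemma word_eval_closed:
  assumes "\<And>g. f g \<in> carrier G"
  shows "word_eval G f w \<in> carrier G"
proof (induction w)
  case (Cons a w)
  then show ?case using assms by (cases a) auto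
qed simp

lemma word_eval_append:
  assumes "\<And>g. f g \<in> carrier G"
  shows "word_eval G f (u @ v) = word_eval G f u \<otimes> word_eval G f v"
proof (induction u)
  case Nil
  show ?case by (simp add: word_eval_closed assms)
next
  case (Cons a u)
  then show ?case using assms by (cases a) (auto simp: word_eval_closed m_assoc)
qed

lemma word_eval_replicate:
  assumes "\<And>g. f g \<in> carrier G"
  shows "word_eval G f (replicate m (g, True)) = f g [^] m"
proof (induction m)
  case (Suc m)
  then have "word_eval G f (replicate (Suc m) (g, True)) = f g \<otimes> f g [^] m"
    by simp
  also have "\<dots> = f g [^] Suc m"
    by (rule nat_pow_Suc2[OF assms, symmetric])
  finally show ?case .
qed simp

lemma word_eval_cong_pres_eq:
  assumes f: "\<And>g. f g \<in> carrier G"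
    and R: "\<And>u v. (u, v) \<in> R \<Longrightarrow> word_eval G f u = word_eval G f v"
    and "pres_eq R u v"
  shows "word_eval G f u = word_eval G f v"
  using \<open>pres_eq R u v\<close>
  by induction (auto simp: word_eval_append f R)

text \<open>The existence half of von Dyck's theorem: evaluation of words respects
  \<open>pres_eq R\<close> as soon as it respects the relations, so it descends to classes.\<close>

lemma presented_group_hom:
  assumes f: "\<And>g. f g \<in> carrier G"
    and R: "\<And>u v. (u, v) \<in> R \<Longrightarrow> word_eval G f u = word_eval G f v"
  shows "\<exists>\<phi>. group_hom (presented_group R) G \<phi> \<and> (\<forall>g. \<phi> (pres_class R [(g, True)]) = f g)"
proof -
  \<comment> \<open>An arbitrary representative is evaluated; \<open>word_eval_cong_pres_eq\<close>
    makes the choice immaterial.\<close>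
  define \<phi> where "\<phi> A = word_eval G f (SOME u. u \<in> A)" for A
  have \<phi>: "\<phi> (pres_class R u) = word_eval G f u" for u
  proof -
    have "u \<in> pres_class R u"
      by (simp add: pres_class_def pres_eq.refl)
    then have "(SOME v. v \<in> pres_class R u) \<in> pres_class R u"
      by (rule someI)
    then have "pres_eq R u (SOME v. v \<in> pres_class R u)"
      by (simp only: pres_class_def mem_Collect_eq)
    from word_eval_cong_pres_eq[of f R, OF f R this] show ?thesis
      unfolding \<phi>_def by simp
  qed
  have "\<phi> \<in> hom (presented_group R) G"
  proof (rule homI)
    fix A B
    assume "A \<in> carrier (presented_group R)" "B \<in> carrier (presented_group R)"
    then obtain u v where AB: "A = pres_class R u" "B = pres_class R v"
      by (auto simp: presented_group_def)
    show "\<phi> A \<in> carrier G"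
      by (simp add: AB \<phi> word_eval_closed f)
    show "\<phi> (A \<otimes>\<^bsub>presented_group R\<^esub> B) = \<phi> A \<otimes> \<phi> B"
      by (simp add: AB \<phi> mult_pres_class word_eval_append f)
  qed
  then have "group_hom (presented_group R) G \<phi>"
    by (simp add: group_hom_def group_hom_axioms_def group_presented_group group_axioms)
  moreover have "\<phi> (pres_class R [(g, True)]) = f g" for g
    by (simp add: \<phi> f)
  ultimately show ?thesis by blast
qed

text \<open>Given \<open>s \<otimes> s = \<one>\<close>, the hypothesis \<open>srsr\<close> is
  equivalent to the third dihedral relation. It is free of inverses and nested to the right, so it
  can be checked by composing maps from the inside out.\<close>

lemma dihedral_group_hom:
  assumes r: "r \<in> carrier G" and s: "s \<in> carrier G"
    and rm: "r [^] m = \<one>" and ss: "s \<otimes> s = \<one>" and srsr: "s \<otimes> (r \<otimes> (s \<otimes> r)) = \<one>"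
  shows "\<exists>\<phi>. group_hom (dihedral_group m) G \<phi> \<and> \<phi> (dih_r m) = r \<and> \<phi> (dih_s m) = s"
proof -
  define f where "f g = (case g of Rot \<Rightarrow> r | Refl \<Rightarrow> s)" for g
  have f: "f g \<in> carrier G" for g
    using r s by (simp add: f_def split: dih_gen.split)
  have inv_s: "inv s = s"
    using ss s by (rule inv_equality) (rule s)
  have "(s \<otimes> (r \<otimes> s)) \<otimes> r = \<one>"
    using srsr r s by (simp add: m_assoc)
  then have inv_r: "inv r = s \<otimes> (r \<otimes> s)"
    using r s by (intro inv_equality) auto
  have "word_eval G f u = word_eval G f v" if "(u, v) \<in> dihedral_rels m" for u v
    using that word_eval_replicate[of f m Rot, OF f]
    by (auto simp: dihedral_rels_def f_def rm ss r s inv_s inv_r)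
  from presented_group_hom[of f "dihedral_rels m", OF f this] show ?thesis
    by (auto simp: dihedral_group_def dih_r_def dih_s_def f_def)
qed

end

section \<open>Automorphism groups of graphs\<close>

text \<open>\<open>graph_aut_group\<close> only shrinks the carrier of \<open>BijGroup\<close>, so
  being a subgroup is what makes it a group.\<close>

lemma graph_auts_subgroup: "subgroup (graph_auts G) (BijGroup (uverts G))"
proof -
  let ?V = "uverts G"
  interpret group "BijGroup ?V" by (rule group_BijGroup)
  show ?thesis
  proof (rule subgroupI)
    show "graph_auts G \<subseteq> carrier (BijGroup ?V)"
      by (auto simp: graph_auts_def BijGroup_def)
    have "restrict id ?V \<in> graph_auts G"
      using id_Bij[of ?V] by (auto simp: graph_auts_def id_def)
    then show "graph_auts G \<noteq> {}" by blast
  next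
    fix f assume f: "f \<in> graph_auts G"
    then have fB: "f \<in> Bij ?V" by (simp add: graph_auts_def)
    then have bij: "bij_betw f ?V ?V" by (simp add: Bij_def)
    have mem: "inv_into ?V f x \<in> ?V" and ff: "f (inv_into ?V f x) = x" if "x \<in> ?V" for x
      using bij that
      by (auto simp: bij_betw_def f_inv_into_f inv_into_into)
    have "({inv_into ?V f x, inv_into ?V f y} \<in> uedges G) \<longleftrightarrow> {x, y} \<in> uedges G"
      if "x \<in> ?V" "y \<in> ?V" for x y
    proof -
      have "{f (inv_into ?V f x), f (inv_into ?V f y)} \<in> uedges G
          \<longleftrightarrow> {inv_into ?V f x, inv_into ?V f y} \<in> uedges G"
        using f mem that unfolding graph_auts_def by blast
      then show ?thesis using ff that by simp
    qed
    then show "inv\<^bsub>BijGroup ?V\<^esub> f \<in> graph_auts G"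
      using restrict_inv_into_Bij[OF fB]
      by (simp add: inv_BijGroup[OF fB] graph_auts_def)
  next
    fix f g assume f: "f \<in> graph_auts G" and g: "g \<in> graph_auts G"
    then have B: "f \<in> Bij ?V" "g \<in> Bij ?V" by (simp_all add: graph_auts_def)
    then have "g x \<in> ?V" if "x \<in> ?V" for x
      using that Bij_imp_funcset by blast
    with f g B show "f \<otimes>\<^bsub>BijGroup ?V\<^esub> g \<in> graph_auts G"
      by (auto simp: BijGroup_def graph_auts_def compose_Bij compose_eq)
  qed
qed

lemma group_graph_aut_group: "group (graph_aut_group G)"
  unfolding graph_aut_group_def
  by (rule subgroup.subgroup_is_group[OF graph_auts_subgroup group_BijGroup])

text \<open>Turns products of extensional maps into plain composition: as \<open>g\<close> stays
  inside the vertex set, the restriction of \<open>f\<close> is invisible.\<close>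

lemma mult_graph_aut_group:
  assumes "f ` uverts G \<subseteq> uverts G" "g ` uverts G \<subseteq> uverts G"
    and "restrict f (uverts G) \<in> graph_auts G" "restrict g (uverts G) \<in> graph_auts G"
  shows "restrict f (uverts G) \<otimes>\<^bsub>graph_aut_group G\<^esub> restrict g (uverts G)
    = restrict (f \<circ> g) (uverts G)"
  using assms by (auto simp: graph_aut_group_def BijGroup_def graph_auts_def compose_def intro!: restrict_ext)

lemma one_graph_aut_group: "\<one>\<^bsub>graph_aut_group G\<^esub> = restrict id (uverts G)"
  by (auto simp: graph_aut_group_def BijGroup_def)

lemma funpow_image_subset: "f ` V \<subseteq> V \<Longrightarrow> (f ^^ m) ` V \<subseteq> V"
  by (induction m) auto

text \<open>For a periodic map, preserving edges in one direction suffices: \<open>f ^^ m\<close>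
  inverts \<open>f\<close> on the vertices and, being an iterate, preserves edges too, so it carries
  the edge \<open>{f x, f y}\<close> back to \<open>{x, y}\<close>.\<close>

lemma restrict_in_graph_auts:
  assumes V: "f ` uverts G \<subseteq> uverts G"
    and E: "\<And>x y. x \<in> uverts G \<Longrightarrow> y \<in> uverts G \<Longrightarrow> {x, y} \<in> uedges G
      \<Longrightarrow> {f x, f y} \<in> uedges G"
    and period: "\<And>x. x \<in> uverts G \<Longrightarrow> (f ^^ Suc m) x = x"
  shows "restrict f (uverts G) \<in> graph_auts G"
proof -
  let ?V = "uverts G"
  have pow_V: "(f ^^ k) x \<in> ?V" if "x \<in> ?V" for k x
    using funpow_image_subset[OF V] that by blast
  have pow_E: "{(f ^^ k) x, (f ^^ k) y} \<in> uedges G"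
    if "x \<in> ?V" "y \<in> ?V" "{x, y} \<in> uedges G" for k x y
    using that by (induction k) (auto intro: E pow_V)
  have period': "(f ^^ m) (f x) = x" if "x \<in> ?V" for x
    using period[OF that] by (simp only: funpow_Suc_right o_apply)
  have "bij_betw f ?V ?V"
    by (rule bij_betw_byWitness[where f' = "f ^^ m"])
      (use V period period' pow_V in auto)
  moreover have "{x, y} \<in> uedges G" if "x \<in> ?V" "y \<in> ?V" "{f x, f y} \<in> uedges G" for x y
    using pow_E[of "f x" "f y" m] that V period' by auto
  ultimately show ?thesis
    by (auto simp: graph_auts_def Bij_def E cong: bij_betw_cong)
qed

lemma pow_graph_aut_group:
  assumes V: "f ` uverts G \<subseteq> uverts G" and f: "restrict f (uverts G) \<in> graph_auts G"
  shows "restrict f (uverts G) [^]\<^bsub>graph_aut_group G\<^esub> (m::nat) = restrict (f ^^ m) (uverts G)"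
proof -
  interpret group "graph_aut_group G" by (rule group_graph_aut_group)
  have car: "carrier (graph_aut_group G) = graph_auts G"
    by (simp add: graph_aut_group_def)
  show ?thesis
  proof (induction m)
    case 0
    show ?case by (simp add: one_graph_aut_group id_def)
  next
    case (Suc m)
    have "restrict (f ^^ m) (uverts G) \<in> graph_auts G"
      using nat_pow_closed[of "restrict f (uverts G)" m] f unfolding car Suc.IH .
    then show ?case
      using mult_graph_aut_group[OF funpow_image_subset[OF V] V] f
      unfolding nat_pow_Suc Suc.IH funpow_Suc_right by blast
  qed
qed

section \<open>Alternation up to a global sign\<close>

definition signs :: "int \<Rightarrow> nat \<Rightarrow> int list" where
  "signs c m = map (\<lambda>i. c * (-1) ^ i) [0..<m]"

lemma signs_Suc: "signs c (Suc m) = signs c m @ [c * (-1) ^ m]"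
  by (simp add: signs_def)

lemma signs_Cons: "signs c (Suc m) = c # signs (- c) m"
  unfolding signs_def by (subst upt_conv_Cons) (auto simp: map_Suc_upt[symmetric] simp del: upt_Suc)

text \<open>An alternating sign pattern of odd length is a palindrome; the induction peels off one
  entry at each end, which flips the leading sign and so needs \<open>c\<close> arbitrary.\<close>

lemma rev_signs_odd: "rev (signs c (Suc (2 * k))) = signs c (Suc (2 * k))"
proof (induction k arbitrary: c)
  case 0
  show ?case by (simp add: signs_def)
next
  case (Suc k)
  have *: "signs c (Suc (2 * Suc k)) = c # signs (- c) (Suc (2 * k)) @ [c]" for c
    using signs_Cons[of c "Suc (Suc (2 * k))"] signs_Suc[of "- c" "Suc (2 * k)"] by simp
  show ?case unfolding * by (simp add: Suc.IH)
qed

lemma uminus_signs: "map uminus (signs c m) = signs (- c) m"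
  by (simp add: signs_def)

text \<open>Swapping two vertices negates their difference, and \<open>theta\<close> may flip the
  global sign, so the leading sign \<open>c\<close> is left free.\<close>

definition alternating_upto_sign :: "int list \<Rightarrow> bool" where
  "alternating_upto_sign d \<longleftrightarrow> set d \<subseteq> {1, 0, -1} \<and>
    (\<exists>c k. c \<in> {1, -1} \<and> filter (\<lambda>a. a \<noteq> 0) d = signs c (Suc (2 * k)))"

lemma alternating_or_uminus:
  "alternating d \<or> alternating (map uminus d) \<longleftrightarrow> alternating_upto_sign d"
proof -
  have filt: "filter (\<lambda>a. a \<noteq> 0) (map uminus d) = signs 1 m
      \<longleftrightarrow> filter (\<lambda>a. a \<noteq> 0) d = signs (-1) m" for m
  proof -
    have "filter (\<lambda>a. a \<noteq> 0) (map uminus d) = map uminus (filter (\<lambda>a. a \<noteq> 0) d)"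
      by (simp add: filter_map o_def)
    moreover have "signs 1 m = map uminus (signs (-1) m)"
      by (simp add: uminus_signs)
    ultimately show ?thesis
      by (simp add: inj_map_eq_map inj_on_def)
  qed
  have alt: "alternating e \<longleftrightarrow> set e \<subseteq> {1, 0, -1} \<and>
      (\<exists>k. filter (\<lambda>a. a \<noteq> 0) e = signs 1 (Suc (2 * k)))" for e
    by (simp add: alternating_def signs_def)
  have "- a \<in> {1, 0, -1} \<longleftrightarrow> a \<in> {1, 0, -1}" for a :: int
    by auto
  then have "set (map uminus d) \<subseteq> {1, 0, -1} \<longleftrightarrow> set d \<subseteq> {1, 0, -1}"
    by (simp only: set_map image_subset_iff subset_eq[of "set d"])
  then show ?thesis
    unfolding alt filt alternating_upto_sign_def by auto
qed

lemma alternating_upto_sign_rev: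
  "alternating_upto_sign d \<Longrightarrow> alternating_upto_sign (rev d)"
  unfolding alternating_upto_sign_def rev_filter[symmetric] set_rev by (metis rev_signs_odd)

text \<open>A zero moves without effect. A nonzero \<open>a\<close> is the last of an odd number of
  alternating signs, hence equals the leading sign \<open>c\<close>; the \<open>2 * k\<close> signs
  that remain start with \<open>c\<close>, so \<open>- c\<close> may be put in front.\<close>

lemma alternating_upto_sign_rotate:
  assumes "alternating_upto_sign (d @ [a])"
  shows "alternating_upto_sign (- a # d)"
proof (cases "a = 0")
  case True
  then show ?thesis using assms by (simp add: alternating_upto_sign_def)
next
  case False
  from assms obtain c k where c: "c \<in> {1, -1}"
    and "filter (\<lambda>a. a \<noteq> 0) (d @ [a]) = signs c (Suc (2 * k))"
    by (auto simp: alternating_upto_sign_def)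
  with False have "filter (\<lambda>a. a \<noteq> 0) d = signs c (2 * k)" "a = c"
    by (auto simp: signs_Suc)
  then have "filter (\<lambda>a. a \<noteq> 0) (- a # d) = signs (- c) (Suc (2 * k))"
    using False by (simp add: signs_Cons)
  moreover have "- c \<in> {1, -1}" "set (- a # d) \<subseteq> {1, 0, -1}"
    using assms c by (auto simp: alternating_upto_sign_def)
  ultimately show ?thesis
    unfolding alternating_upto_sign_def by blast
qed

section \<open>The maps theta and tau\<close>

text \<open>The set \<open>{x, y}\<close> can be matched in either order; symmetry under negation
  makes one order enough.\<close>

lemma Phi_hat_edge_iff:
  "{x, y} \<in> uedges (Phi_hat n) \<longleftrightarrow>
    x \<in> bin_seqs n \<and> y \<in> bin_seqs n \<and> x \<noteq> y \<and> alternating_upto_sign (seq_diff y x)"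
proof -
  have swap: "seq_diff x y = map uminus (seq_diff y x)" for x y
    unfolding seq_diff_def by (rule nth_equalityI) auto
  have "alternating (seq_diff y x) \<or> alternating (seq_diff x y)
      \<longleftrightarrow> alternating_upto_sign (seq_diff y x)" for x y
    by (subst swap[of x y]) (rule alternating_or_uminus)
  then show ?thesis
    by (simp add: Phi_hat_def doubleton_eq_iff) (metis (no_types, lifting))
qed

lemma theta_snoc: "theta (xs @ [a]) = (1 - a) # xs"
  by (simp add: theta_def)

lemma bin_seqs_Suc_cases:
  assumes "x \<in> bin_seqs (Suc m)"
  obtains xs a where "x = xs @ [a]" "length xs = m"
  using assms by (cases x rule: rev_cases) (auto simp: bin_seqs_def)

lemma theta_bin_seqs:
  assumes "x \<in> bin_seqs (Suc m)"
  shows "theta x \<in> bin_seqs (Suc m)"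
proof -
  obtain xs a where "x = xs @ [a]" "length xs = m"
    using assms by (rule bin_seqs_Suc_cases)
  then show ?thesis using assms by (auto simp: theta_snoc bin_seqs_def)
qed

lemma tau_bin_seqs: "x \<in> bin_seqs n \<Longrightarrow> tau x \<in> bin_seqs n"
  by (simp add: tau_def bin_seqs_def)

lemma theta_edge:
  assumes "{x, y} \<in> uedges (Phi_hat (Suc m))"
  shows "{theta x, theta y} \<in> uedges (Phi_hat (Suc m))"
proof -
  from assms have x: "x \<in> bin_seqs (Suc m)" and y: "y \<in> bin_seqs (Suc m)"
    and "x \<noteq> y" and alt: "alternating_upto_sign (seq_diff y x)"
    by (simp_all add: Phi_hat_edge_iff)
  obtain xs a where xs: "x = xs @ [a]" "length xs = m"
    using x by (rule bin_seqs_Suc_cases)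
  obtain ys b where ys: "y = ys @ [b]" "length ys = m"
    using y by (rule bin_seqs_Suc_cases)
  \<comment> \<open>Complementing both last entries negates their difference:
    \<open>(1 - b) - (1 - a) = - (b - a)\<close>.\<close>
  have "seq_diff (theta y) (theta x) = - (b - a) # seq_diff ys xs"
    by (simp add: xs ys theta_snoc seq_diff_def)
  moreover have "seq_diff y x = seq_diff ys xs @ [b - a]"
    by (simp add: xs ys seq_diff_def)
  ultimately have "alternating_upto_sign (seq_diff (theta y) (theta x))"
    using alt alternating_upto_sign_rotate by metis
  moreover have "theta x \<noteq> theta y"
    using \<open>x \<noteq> y\<close> by (auto simp: xs ys theta_snoc)
  ultimately show ?thesis
    by (simp add: Phi_hat_edge_iff theta_bin_seqs x y)
qed

lemma tau_edge:
  assumes "{x, y} \<in> uedges (Phi_hat n)"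
  shows "{tau x, tau y} \<in> uedges (Phi_hat n)"
proof -
  from assms have x: "x \<in> bin_seqs n" and y: "y \<in> bin_seqs n"
    and "x \<noteq> y" and alt: "alternating_upto_sign (seq_diff y x)"
    by (simp_all add: Phi_hat_edge_iff)
  have "seq_diff (tau y) (tau x) = rev (seq_diff y x)"
    using x y by (simp add: seq_diff_def tau_def bin_seqs_def zip_rev rev_map)
  then show ?thesis
    using alt x y \<open>x \<noteq> y\<close>
    by (simp add: Phi_hat_edge_iff tau_bin_seqs alternating_upto_sign_rev) (simp add: tau_def)
qed

text \<open>With \<open>xs\<close> empty this says that \<open>theta ^^ n\<close> complements a
  sequence of length \<open>n\<close>. The prefix is general because each step of the induction adds
  an entry to it.\<close>

lemma theta_funpow_length: "(theta ^^ length ys) (xs @ ys) = map (\<lambda>a. 1 - a) ys @ xs"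
proof (induction ys arbitrary: xs rule: rev_induct)
  case (snoc a ys)
  have "(theta ^^ length (ys @ [a])) (xs @ ys @ [a])
      = (theta ^^ length ys) (theta ((xs @ ys) @ [a]))"
    by (simp add: funpow_swap1)
  also have "\<dots> = (theta ^^ length ys) (((1 - a) # xs) @ ys)"
    by (simp only: theta_snoc append_Cons)
  finally show ?case
    by (simp only: snoc.IH) simp
qed simp

lemma theta_period:
  assumes "length x = n"
  shows "(theta ^^ (2 * n)) x = x"
proof -
  have "(theta ^^ n) y = map (\<lambda>a. 1 - a) y" if "length y = n" for y
    using theta_funpow_length[of y "[]"] that by simp
  then show ?thesis
    using assms by (simp add: mult_2 funpow_add o_def)
qed

theorem theorem4p12:
  fixes n :: nat
  assumes "n \<ge> 1"
  shows "\<exists>\<phi>. group_hom (dihedral_group (2 * n)) (graph_aut_group (Phi_hat n)) \<phi> \<and>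
    \<phi> (dih_r (2 * n)) = restrict theta (uverts (Phi_hat n)) \<and>
    \<phi> (dih_s (2 * n)) = restrict tau (uverts (Phi_hat n))"
proof -
  obtain m where n: "n = Suc m" using assms by (cases n) auto
  let ?G = "Phi_hat n"
  let ?V = "uverts ?G"
  interpret group "graph_aut_group ?G" by (rule group_graph_aut_group)
  have V: "?V = bin_seqs n"
    by (simp add: Phi_hat_def)
  have car: "carrier (graph_aut_group ?G) = graph_auts ?G"
    by (simp add: graph_aut_group_def)
  have theta_V: "theta ` ?V \<subseteq> ?V" and tau_V: "tau ` ?V \<subseteq> ?V"
    unfolding V by (auto simp: n theta_bin_seqs tau_bin_seqs)
  have period: "(theta ^^ (2 * n)) x = x" if "x \<in> ?V" for x
    using that by (simp add: V bin_seqs_def theta_period)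
  have theta: "restrict theta ?V \<in> graph_auts ?G"
    \<comment> \<open>\<open>Suc m\<close> has to be the period \<open>2 * n\<close>; for
      \<open>tau\<close> below it is \<open>2\<close>.\<close>
    by (rule restrict_in_graph_auts[where m = "2 * n - 1"])
      (use theta_V period in \<open>auto simp: n intro: theta_edge simp del: funpow.simps\<close>)
  have tau: "restrict tau ?V \<in> graph_auts ?G"
    by (rule restrict_in_graph_auts[where m = 1])
      (use tau_V in \<open>auto simp: tau_edge\<close>, simp add: tau_def)
  \<comment> \<open>Membership of the composites allows \<open>mult_graph_aut_group\<close> to be
    applied again to each longer product.\<close>
  have prod: "restrict (f \<circ> g) ?V \<in> graph_auts ?G"
    if "f ` ?V \<subseteq> ?V" "g ` ?V \<subseteq> ?V" "restrict f ?V \<in> graph_auts ?G" "restrict g ?V \<in> graph_auts ?G"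
    for f g
    using m_closed[of "restrict f ?V" "restrict g ?V"] that by (simp add: car mult_graph_aut_group)
  have tt_V: "(tau \<circ> theta) ` ?V \<subseteq> ?V" and ttt_V: "(theta \<circ> (tau \<circ> theta)) ` ?V \<subseteq> ?V"
    using theta_V tau_V by auto
  \<comment> \<open>\<open>tau \<circ> theta\<close> sends \<open>xs @ [a]\<close> to
    \<open>rev xs @ [1 - a]\<close>, which is undone by a second application.\<close>
  have involution: "tau (theta (tau (theta x))) = x" if x: "x \<in> ?V" for x
  proof -
    obtain xs a where "x = xs @ [a]"
      using x bin_seqs_Suc_cases by (metis V n)
    then show ?thesis by (simp add: theta_snoc tau_def)
  qed
  show ?thesis
  proof (rule dihedral_group_hom)
    show "restrict theta ?V [^]\<^bsub>graph_aut_group ?G\<^esub> (2 * n) = \<one>\<^bsub>graph_aut_group ?G\<^esub>"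
      unfolding pow_graph_aut_group[OF theta_V theta] one_graph_aut_group
      by (rule restrict_ext) (simp add: period)
    show "restrict tau ?V \<otimes>\<^bsub>graph_aut_group ?G\<^esub> restrict tau ?V = \<one>\<^bsub>graph_aut_group ?G\<^esub>"
      unfolding mult_graph_aut_group[OF tau_V tau_V tau tau] one_graph_aut_group
      by (rule restrict_ext) (simp add: tau_def)
    show "restrict tau ?V \<otimes>\<^bsub>graph_aut_group ?G\<^esub> (restrict theta ?V \<otimes>\<^bsub>graph_aut_group ?G\<^esub>
        (restrict tau ?V \<otimes>\<^bsub>graph_aut_group ?G\<^esub> restrict theta ?V)) = \<one>\<^bsub>graph_aut_group ?G\<^esub>"
      unfolding mult_graph_aut_group[OF tau_V theta_V tau theta]
        mult_graph_aut_group[OF theta_V tt_V theta prod[OF tau_V theta_V tau theta]]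
        mult_graph_aut_group[OF tau_V ttt_V tau
          prod[OF theta_V tt_V theta prod[OF tau_V theta_V tau theta]]]
        one_graph_aut_group
      by (rule restrict_ext) (simp add: involution)
  qed (simp_all add: car theta tau)
qed

end
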